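(* For each integer $h\ge 0$, let $m_h$ denote the number of minimal vertex covers of a perfect binary tree of height $h$. Then $m_0=1$, $m_1=2$, $m_2=4$, and $$m_{h+1}=2m_h\,m_{h-2}^4+m_{h-1}^4-m_{h-2}^8\qquad\text{for all } h\ge 2.$$
   Context: A perfect binary tree is a rooted tree in which every non-leaf vertex has exactly two children and all leaves lie at the same distance (number of edges) from the root; this common distance is the height $h$ of the tree. The perfect binary tree of height $0$ is a single vertex. It is regarded as a finite simple graph. A vertex cover of a finite simple graph $G$ is a subset $C\subseteq V(G)$ meeting every edge of $G$; it is minimal if no proper subset of $C$ is a vertex cover (for a graph with no edges, the empty set is the unique minimal vertex cover). *)

theory Defs
  imports "Graph_Theory.Graph_Theory"
begin

text \<open>
  Finite simple graphs are the locale \<^locale>\<open>pair_graph\<close>: an edge between \<open>u\<close> and \<open>v\<close> is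
  represented by the two arcs \<open>(u, v)\<close> and \<open>(v, u)\<close>.
\<close>

definition vertex_cover :: "'a pair_pre_digraph \<Rightarrow> 'a set \<Rightarrow> bool" where
  "vertex_cover G C \<longleftrightarrow> C \<subseteq> pverts G \<and> (\<forall>(u, v) \<in> parcs G. u \<in> C \<or> v \<in> C)"

definition minimal_vertex_cover :: "'a pair_pre_digraph \<Rightarrow> 'a set \<Rightarrow> bool" where
  "minimal_vertex_cover G C \<longleftrightarrow> vertex_cover G C \<and> (\<forall>D. D \<subset> C \<longrightarrow> \<not> vertex_cover G D)"

text \<open>
  The library predicate \<^const>\<open>tree\<close> is not usable here: in a symmetric digraph every edge gives a
  directed cycle \<open>u, v, u\<close>. The cycles of the undirected graph are the directed cycles with at
  least three arcs.
\<close>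

locale rooted_tree = pair_graph T for T :: "'a pair_pre_digraph" +
  fixes r :: 'a
  assumes root_in_verts: "r \<in> pverts T"
    and connected: "Digraph_Component.connected T"
    and acyclic: "\<not> (\<exists>p. cycle p \<and> length p \<ge> 3)"
begin

definition depth :: "'a \<Rightarrow> nat" where
  "depth v = (LEAST n. \<exists>p. awalk r p v \<and> length p = n)"

definition children :: "'a \<Rightarrow> 'a set" where
  "children v = {w. (v, w) \<in> parcs T \<and> depth w = depth v + 1}"

definition leaf :: "'a \<Rightarrow> bool" where
  "leaf v \<longleftrightarrow> v \<in> pverts T \<and> children v = {}"

end

locale perfect_binary_tree = rooted_tree T r for T :: "'a pair_pre_digraph" and r :: 'a +
  fixes h :: nat
  assumes two_children: "v \<in> pverts T \<Longrightarrow> \<not> leaf v \<Longrightarrow> card (children v) = 2"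
    and leaf_depth: "leaf v \<Longrightarrow> depth v = h"


subsection \<open>Perfect binary trees of every height exist\<close>

definition binary_words_tree :: "nat \<Rightarrow> bool list pair_pre_digraph" where
  "binary_words_tree h =
    \<lparr> pverts = {xs. length xs \<le> h},
      parcs = {(xs, ys). length xs \<le> h \<and> length ys \<le> h \<and> (\<exists>b. ys = b # xs \<or> xs = b # ys)} \<rparr>"

lemma finite_binary_words: "finite {xs :: bool list. length xs \<le> h}"
  using finite_lists_length_le[of "UNIV :: bool set" h] by simp

lemma pair_graph_binary_words_tree: "pair_graph (binary_words_tree h)"
proof
  have "parcs (binary_words_tree h) \<subseteq> {xs. length xs \<le> h} \<times> {xs. length xs \<le> h}"
    by (auto simp: binary_words_tree_def)
  then show "finite (parcs (binary_words_tree h))"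
    by (rule finite_subset) (simp add: finite_binary_words)
  show "symmetric (with_proj (binary_words_tree h))"
    by (auto simp: symmetric_def sym_def binary_words_tree_def)
qed (auto simp: binary_words_tree_def finite_binary_words)

lemma (in pair_wf_digraph) awalk_nth_arc:
  assumes "awalk u p v" "k < length p"
  shows "p ! k = (awalk_verts u p ! k, awalk_verts u p ! Suc k)"
  using assms
proof (induction p arbitrary: u k)
  case (Cons e p)
  obtain a b where e: "e = (a, b)" by (cases e)
  have "awalk b p v" using Cons.prems e by (simp add: awalk_Cons_iff)
  then have hd: "awalk_verts b p ! 0 = b"
    by (cases p) (auto simp: awalk_Cons_iff)
  show ?case
    using Cons.IH[OF \<open>awalk b p v\<close>] Cons.prems hd e
    by (cases k) (auto simp: awalk_Cons_iff)
qed simp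

lemma perfect_binary_tree_binary_words: "perfect_binary_tree (binary_words_tree h) [] h"
proof -
  let ?T = "binary_words_tree h"
  interpret G: pair_graph ?T by (rule pair_graph_binary_words_tree)
  have verts: "xs \<in> pverts ?T \<longleftrightarrow> length xs \<le> h" for xs
    by (simp add: binary_words_tree_def)
  have arcs: "(xs, ys) \<in> parcs ?T \<longleftrightarrow>
      length xs \<le> h \<and> length ys \<le> h \<and> (\<exists>b. ys = b # xs \<or> xs = b # ys)" for xs ys
    by (simp add: binary_words_tree_def)
  have walk: "\<exists>p. G.awalk [] p xs \<and> length p = length xs" if "length xs \<le> h" for xs
    using that
  proof (induction xs)
    case Nil
    show ?case by (auto simp: G.awalk_Nil_iff verts intro!: exI[of _ "[]"])
  next
    case (Cons b xs)
    then obtain p where p: "G.awalk [] p xs" "length p = length xs" by auto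
    have "G.awalk xs [(xs, b # xs)] (b # xs)"
      using Cons.prems by (simp add: G.awalk_Cons_iff G.awalk_Nil_iff arcs verts)
    with p(1) have "G.awalk [] (p @ [(xs, b # xs)]) (b # xs)"
      by (rule G.awalk_appendI)
    with p(2) show ?case by (intro exI[of _ "p @ [(xs, b # xs)]"]) simp
  qed
  have walk_length: "length ys \<le> length xs + length p" if "G.awalk xs p ys" for xs p ys
    using that
  proof (induction p arbitrary: xs)
    case (Cons e p)
    obtain a b where e: "e = (a, b)" by (cases e)
    from Cons.prems e have "length b \<le> length xs + 1" "G.awalk b p ys"
      by (auto simp: G.awalk_Cons_iff arcs)
    with Cons.IH[of b] show ?case by simp
  qed (simp add: G.awalk_Nil_iff)
  have "Digraph_Component.connected ?T"
    unfolding Digraph_Component.connected_def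
  proof (rule strongly_connectedI)
    show "verts (mk_symmetric ?T) \<noteq> {}" using verts[of "[]"] by auto
  next
    fix u v assume "u \<in> verts (mk_symmetric ?T)" "v \<in> verts (mk_symmetric ?T)"
    then have "[] \<rightarrow>\<^sup>*\<^bsub>?T\<^esub> u" "[] \<rightarrow>\<^sup>*\<^bsub>?T\<^esub> v"
      using walk[of u] walk[of v] by (auto simp: G.reachable_awalk verts)
    then have "u \<rightarrow>\<^sup>*\<^bsub>?T\<^esub> v"
      using G.symmetric_reachable' G.reachable_trans by blast
    then show "u \<rightarrow>\<^sup>*\<^bsub>mk_symmetric ?T\<^esub> v"
      by (rule G.reachable_mk_symmetricI)
  qed
  moreover have "\<not> (\<exists>p. G.cycle p \<and> length p \<ge> 3)"
  proof
    assume "\<exists>p. G.cycle p \<and> length p \<ge> 3"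
    then obtain p u where p: "G.awalk u p u" "distinct (tl (G.awalk_verts u p))" "length p \<ge> 3"
      by (auto simp: G.cycle_def)
    define n where "n = length p"
    define f where "f k = G.awalk_verts u p ! k" for k
    have len: "length (G.awalk_verts u p) = Suc n"
      by (simp add: n_def G.length_awalk_verts)
    have arc: "(f k, f (Suc k)) \<in> parcs ?T" if "k < n" for k
      using G.awalk_nth_arc[OF p(1), of k] that p(1)
      by (metis G.awalkE f_def n_def nth_mem subsetD)
    have ends: "f 0 = u" "f n = u"
    proof -
      have ne: "G.awalk_verts u p \<noteq> []" using len by auto
      show "f 0 = u" using G.awhd_of_awalk[OF p(1)] ne by (simp add: f_def hd_conv_nth)
      show "f n = u" using G.awlast_of_awalk[OF p(1)] ne len by (simp add: f_def last_conv_nth)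
    qed
    have inj: "i = j" if ij: "f i = f j" "i \<in> {1..n}" "j \<in> {1..n}" for i j
    proof -
      obtain i' j' where "i = Suc i'" "j = Suc j'"
        using ij by (cases i; cases j) auto
      then show ?thesis
        using p(2) len ij by (simp add: f_def nth_tl[symmetric] nth_eq_iff_index_eq)
    qed
    have n3: "n \<ge> 3" using p(3) by (simp add: n_def)
    obtain i where i: "i \<in> {1..n}" "\<And>k. k \<in> {1..n} \<Longrightarrow> length (f k) \<le> length (f i)"
    proof -
      let ?M = "Max ((length \<circ> f) ` {1..n})"
      have "?M \<in> (length \<circ> f) ` {1..n}" using n3 by (intro Max_in) auto
      then obtain i where "i \<in> {1..n}" "length (f i) = ?M" by auto
      moreover have "length (f k) \<le> ?M" if "k \<in> {1..n}" for k
        using that by (auto intro!: Max_ge)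
      ultimately show thesis using that by metis
    qed
    have max: "length (f k) \<le> length (f i)" if "k \<le> n" for k
      using i(2)[of k] i(2)[of n] that ends n3 by (cases "k = 0") auto
    have tl: "xs = tl ys" if "(xs, ys) \<in> parcs ?T \<or> (ys, xs) \<in> parcs ?T" "length xs \<le> length ys"
      for xs ys
      using that by (auto simp: arcs)
    have "f (i - 1) = tl (f i)"
      using arc[of "i - 1"] max[of "i - 1"] i(1) by (intro tl) auto
    moreover define j where "j = (if i = n then 1 else Suc i)"
    moreover have "f j = tl (f i)"
    proof (cases "i = n")
      case True
      then show ?thesis using arc[of 0] max[of 1] n3 ends by (intro tl) (auto simp: j_def)
    next
      case False
      then show ?thesis using arc[of i] max[of "Suc i"] i(1) by (intro tl) (auto simp: j_def)
    qed
    ultimately have eq: "f (i - 1) = f j" by simp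
    show False
    proof (cases "i = 1")
      case True
      then show False using inj[of n j] eq ends n3 by (auto simp: j_def)
    next
      case False
      then have "i - 1 \<in> {1..n}" "j \<in> {1..n}" using i(1) by (auto simp: j_def)
      then have "i - 1 = j" using inj eq by blast
      then show False using i(1) n3 by (auto simp: j_def split: if_splits)
    qed
  qed
  ultimately interpret R: rooted_tree ?T "[]"
    by unfold_locales (auto simp: verts)
  have depth: "R.depth xs = length xs" if "length xs \<le> h" for xs
    unfolding R.depth_def
    using walk[OF that] walk_length[of "[]"] by (intro Least_equality) auto
  have children: "R.children xs = (if length xs < h then {True # xs, False # xs} else {})"
    if "length xs \<le> h" for xs
    using that by (auto simp: R.children_def arcs depth)
  show ?thesis
    by unfold_locales (auto simp: R.leaf_def verts children depth split: if_splits)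
qed

end

theory Submission
  imports Defs
begin

text \<open>
  A vertex cover is minimal iff each of its vertices has a neighbour outside the cover. For a tree
  with root \<open>r\<close> whose children \<open>c\<^sub>1\<close>, \<open>c\<^sub>2\<close> carry the subtrees \<open>G\<^sub>1\<close>, \<open>G\<^sub>2\<close>, this condition can be
  checked on the two subtrees separately, up to what happens along the edges \<open>r c\<^sub>1\<close> and \<open>r c\<^sub>2\<close>. Write
  \<open>a\<close> and \<open>b\<close> for the numbers of minimal covers of a subtree with and without its root, \<open>n = a + b\<close>, and
  \<open>w\<close> for the number of covers that contain the root and in which every vertex other than the root has
  an outside neighbour.

  \<^item> If \<open>r\<close> lies in the cover, the edges at \<open>r\<close> are covered and \<open>r\<close> gives no outside neighbour to its
    children, so both restrictions are minimal covers. This gives \<open>n\<^sup>2\<close> covers in which all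
    vertices except perhaps \<open>r\<close> have an outside neighbour (\<open>forced_root_J\<close>); the root fails to have
    one exactly when both restrictions contain their roots, which leaves \<open>n\<^sup>2 - a\<^sup>2\<close>
    minimal covers (\<open>with_root_J\<close>).
  \<^item> If \<open>r\<close> lies outside the cover, both children must be in it and \<open>r\<close> is an outside neighbour of each
    of them, which leaves \<open>w\<^sup>2\<close> minimal covers (\<open>without_root_J\<close>).

  So \<open>(a, b, w)\<close> becomes \<open>(n\<^sup>2 - a\<^sup>2, w\<^sup>2, n\<^sup>2)\<close>. From height 2 on, the number of minimal
  covers without the root is thus the fourth power of the total number two levels below, and eliminating \<open>a\<close>,
  \<open>b\<close> and \<open>w\<close> gives the recurrence for \<open>n\<close>.

  The other half of the proof is that a perfect binary tree, given as a connected graph without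
  cycles, does decompose in this way (\<open>recursive_tree\<close>). Acyclicity shows that every arc joins a
  vertex to one of its children and that no vertex has two parents; hence the vertices below the two
  children are disjoint, and no arc runs between them.
\<close>

section \<open>Rooted trees\<close>

context rooted_tree
begin

lemma depth_le_length: "awalk r p v \<Longrightarrow> depth v \<le> length p"
  unfolding depth_def by (rule Least_le) auto

lemma ex_awalk_of_length_depth:
  assumes "v \<in> pverts T"
  shows "\<exists>p. awalk r p v \<and> length p = depth v"
proof -
  have "strongly_connected T"
    using sym_arcs connected by (rule symmetric_connected_imp_strongly_connected)
  then have "r \<rightarrow>\<^sup>*\<^bsub>T\<^esub> v"
    using assms root_in_verts by (auto simp: strongly_connected_def)
  then have "\<exists>n p. awalk r p v \<and> length p = n"
    by (auto simp: reachable_awalk)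
  then show ?thesis
    unfolding depth_def by (rule LeastI_ex)
qed

lemma depth_root [simp]: "depth r = 0"
  using depth_le_length[of "[]" r] root_in_verts by (simp add: awalk_Nil_iff)

lemma depth_arc:
  assumes "(u, v) \<in> parcs T"
  shows "depth v \<le> depth u + 1"
proof -
  obtain p where p: "awalk r p u" "length p = depth u"
    using ex_awalk_of_length_depth in_arcsD1[OF assms] by blast
  have "awalk u [(u, v)] v"
    using assms by (simp add: awalk_simps in_arcsD2)
  then have "awalk r (p @ [(u, v)]) v"
    using p(1) by simp
  from depth_le_length[OF this] p(2) show ?thesis
    by simp
qed

lemma ex_parent:
  assumes "v \<in> pverts T" "v \<noteq> r"
  shows "\<exists>u. v \<in> children u"
proof -
  obtain p where p: "awalk r p v" "length p = depth v"
    using ex_awalk_of_length_depth assms(1) by blast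
  have "p \<noteq> []"
    using p(1) assms(2) by (auto simp: awalk_Nil_iff)
  then have "p = butlast p @ [(fst (last p), snd (last p))]"
    by simp
  then obtain q u w where "p = q @ [(u, w)]"
    by blast
  with p(1) have q: "p = q @ [(u, v)]" "awalk r q u" "(u, v) \<in> parcs T"
    by (auto simp: awalk_simps)
  have "depth v = depth u + 1"
    using depth_le_length[OF q(2)] depth_arc[OF q(3)] p(2) q(1) by simp
  with q(3) have "v \<in> children u"
    unfolding children_def by simp
  then show ?thesis ..
qed

lemma childrenD:
  assumes "w \<in> children v"
  shows "(v, w) \<in> parcs T" "(w, v) \<in> parcs T" "v \<in> pverts T" "w \<in> pverts T"
    "depth w = Suc (depth v)"
proof -
  show arc: "(v, w) \<in> parcs T" and "depth w = Suc (depth v)"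
    using assms by (simp_all add: children_def)
  show "(w, v) \<in> parcs T"
    using arc by (rule arcs_symmetric)
  show "v \<in> pverts T" "w \<in> pverts T"
    using arc by (rule in_arcsD1, rule in_arcsD2)
qed

text \<open>
  Suppose that a path between two vertices at depth \<open>d\<close> stays at depth at least \<open>d\<close>. Adding the parents
  of its two ends gives either a cycle, if the parents coincide, or a longer path of the same kind one
  level higher; and at depth 0 there is only one vertex.
\<close>

lemma path_between_equal_depths_rises:
  assumes "apath u p v" "p \<noteq> []" "depth u = d" "depth v = d"
  shows "\<exists>x \<in> set (awalk_verts u p). depth x < d"
  using assms
proof (induction d arbitrary: u v p)
  case 0
  have "u \<in> pverts T" "v \<in> pverts T" "u \<noteq> v"
    using 0 apath_nonempty_ends by (auto simp: apath_def)
  then have "u = r" "v = r"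
    using ex_parent childrenD(5) 0 by fastforce+
  with \<open>u \<noteq> v\<close> show ?case by simp
next
  case (Suc d)
  show ?case
  proof (rule ccontr)
    assume "\<not> ?thesis"
    then have low: "depth x \<ge> Suc d" if "x \<in> set (awalk_verts u p)" for x
      using that by force
    have "u \<in> pverts T" "v \<in> pverts T" "u \<noteq> v"
      using Suc.prems apath_nonempty_ends by (auto simp: apath_def)
    moreover have "u \<noteq> r" "v \<noteq> r"
      using Suc.prems by auto
    ultimately obtain u' v' where u': "u \<in> children u'" and v': "v \<in> children v'"
      using ex_parent by metis
    have d: "depth u' = d" "depth v' = d"
      using u' v' childrenD(5) Suc.prems by fastforce+
    then have out: "u' \<notin> set (awalk_verts u p)" "v' \<notin> set (awalk_verts u p)"
      using low by fastforce+
    have p: "awalk u p v" "distinct (awalk_verts u p)"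
      using Suc.prems(1) by (auto simp: apath_def)
    have walk: "awalk u' ((u', u) # p @ [(v, v')]) v'"
      using p(1) childrenD[OF u'] childrenD[OF v'] by (simp add: awalk_simps)
    have verts: "awalk_verts u' ((u', u) # p @ [(v, v')]) = u' # awalk_verts u p @ [v']"
      using walk p(1) awalk_verts_append[of u p "[(v, v')]" v'] by (simp add: awalk_Cons_iff)
    show False
    proof (cases "u' = v'")
      case True
      have "length p \<ge> 1"
        using Suc.prems(2) by (cases p) auto
      moreover have "cycle ((u', u) # p @ [(v, v')])"
        unfolding cycle_def using walk verts out True p(2)
        by (intro exI[of _ u']) simp
      ultimately show False
        using acyclic by fastforce
    next
      case False
      then have "apath u' ((u', u) # p @ [(v, v')]) v'"
        using walk verts out p(2) by (simp add: apath_def)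
      from Suc.IH[OF this _ d] obtain x
        where "x = u' \<or> x \<in> set (awalk_verts u p) \<or> x = v'" "depth x < d"
        unfolding verts by auto
      then show False
        using d low[of x] by auto
    qed
  qed
qed

text \<open>
  Two parents \<open>u\<close>, \<open>v\<close> of \<open>w\<close> would be joined by the path \<open>u, w, v\<close>, which stays at or below their
  depth.
\<close>

lemma unique_parent:
  assumes "w \<in> children u" "w \<in> children v"
  shows "u = v"
proof (rule ccontr)
  assume "u \<noteq> v"
  then have "apath u [(u, w), (w, v)] v"
    using childrenD[OF assms(1)] childrenD[OF assms(2)] no_loops'
    by (auto simp: apath_simps)
  then show False
    using path_between_equal_depths_rises[of u "[(u, w), (w, v)]" v "depth u"]
      childrenD(5)[OF assms(1)] childrenD(5)[OF assms(2)]
    by simp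
qed

text \<open>
  Depths of adjacent vertices differ by at most 1, and an arc between vertices of equal depth would
  be a path that does not rise.
\<close>

lemma arc_parent_child:
  assumes "(u, v) \<in> parcs T"
  shows "v \<in> children u \<or> u \<in> children v"
proof (rule ccontr)
  assume "\<not> ?thesis"
  then have eq: "depth v = depth u"
    using depth_arc[OF assms] depth_arc[OF arcs_symmetric[OF assms]] assms arcs_symmetric[OF assms]
    unfolding children_def mem_Collect_eq by linarith
  have "apath u [(u, v)] v"
    using assms no_loops'[OF assms] in_arcsD2[OF assms] by (simp add: apath_simps)
  from path_between_equal_depths_rises[OF this _ refl eq] show False
    using eq by simp
qed

definition descendants :: "'a \<Rightarrow> 'a set" where
  "descendants v = {w. (v, w) \<in> {(a, b). b \<in> children a}\<^sup>*}"

definition subtree :: "'a \<Rightarrow> 'a pair_pre_digraph" where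
  "subtree v = \<lparr> pverts = descendants v, parcs = parcs T \<inter> descendants v \<times> descendants v \<rparr>"

lemma self_in_descendants [simp]: "v \<in> descendants v"
  by (simp add: descendants_def)

lemma descendants_step: "a \<in> descendants v \<Longrightarrow> b \<in> children a \<Longrightarrow> b \<in> descendants v"
  unfolding descendants_def by (simp add: rtrancl.rtrancl_into_rtrancl)

lemma descendants_unfold: "descendants v = insert v (\<Union>c \<in> children v. descendants c)"
proof
  show "descendants v \<subseteq> insert v (\<Union>c \<in> children v. descendants c)"
  proof
    fix w assume "w \<in> descendants v"
    then have "(v, w) \<in> {(a, b). b \<in> children a}\<^sup>*"
      by (simp add: descendants_def)
    then show "w \<in> insert v (\<Union>c \<in> children v. descendants c)"
      by (cases rule: converse_rtranclE) (auto simp: descendants_def)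
  qed
  show "insert v (\<Union>c \<in> children v. descendants c) \<subseteq> descendants v"
    unfolding descendants_def by (auto intro: converse_rtrancl_into_rtrancl)
qed

lemma depth_descendants:
  assumes "w \<in> descendants v"
  shows "w = v \<or> depth v < depth w"
proof -
  have "(v, w) \<in> {(a, b). b \<in> children a}\<^sup>*"
    using assms by (simp add: descendants_def)
  then show ?thesis
    by (induction rule: rtrancl_induct) (auto dest: childrenD(5))
qed

lemma root_notin_child_subtree:
  assumes "c \<in> children v"
  shows "v \<notin> pverts (subtree c)"
proof
  assume "v \<in> pverts (subtree c)"
  then have "depth c \<le> depth v"
    using depth_descendants[of v c] by (auto simp: subtree_def)
  then show False
    using childrenD(5)[OF assms] by simp
qed

text \<open>
  Since parents are unique, the ancestors of a vertex form a chain, which has only one member at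
  each depth.
\<close>

lemma descendants_disjoint:
  assumes "depth a = depth b" "a \<noteq> b"
  shows "descendants a \<inter> descendants b = {}"
proof -
  have "w \<notin> descendants b" if "(a, w) \<in> {(a, b). b \<in> children a}\<^sup>*" for w
    using that
  proof (induction rule: rtrancl_induct)
    case base
    show ?case using depth_descendants[of a b] assms by auto
  next
    case (step y z)
    show ?case
    proof
      assume "z \<in> descendants b"
      then have "(b, z) \<in> {(a, b). b \<in> children a}\<^sup>*"
        by (simp add: descendants_def)
      then show False
      proof (cases rule: rtranclE)
        case base
        have "depth a \<le> depth y"
          using step.hyps(1) depth_descendants[of y a] by (auto simp: descendants_def)
        then show False
          using base step.hyps(2) childrenD(5)[of z y] assms(1) by simp
      next
        case (step y')
        then have "y' = y"
          using \<open>(y, z) \<in> _\<close> unique_parent by auto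
        then show False
          using step.IH step by (simp add: descendants_def)
      qed
    qed
  qed
  then show ?thesis
    by (auto simp: descendants_def)
qed

lemma descendants_root: "descendants r = pverts T"
proof
  have "w \<in> pverts T" if "(r, w) \<in> {(a, b). b \<in> children a}\<^sup>*" for w
    using that by (induction rule: rtrancl_induct) (auto simp: root_in_verts dest: childrenD(4))
  then show "descendants r \<subseteq> pverts T"
    by (auto simp: descendants_def)
next
  have "v \<in> descendants r" if "v \<in> pverts T" "depth v = n" for v n
    using that
  proof (induction n arbitrary: v)
    case 0
    then have "v = r"
      using ex_parent childrenD(5) by fastforce
    then show ?case by simp
  next
    case (Suc n)
    then obtain u where "v \<in> children u"
      using ex_parent[of v] by fastforce
    then show ?case
      using Suc childrenD[of v u] by (auto intro: descendants_step)
  qed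
  then show "pverts T \<subseteq> descendants r"
    by blast
qed

end

section \<open>Recursive structure of perfect binary trees\<close>

definition join_at_root ::
  "'a \<Rightarrow> 'a pair_pre_digraph \<Rightarrow> 'a \<Rightarrow> 'a pair_pre_digraph \<Rightarrow> 'a \<Rightarrow> 'a pair_pre_digraph" where
  "join_at_root r G\<^sub>1 c\<^sub>1 G\<^sub>2 c\<^sub>2 =
    \<lparr> pverts = insert r (pverts G\<^sub>1 \<union> pverts G\<^sub>2),
      parcs = parcs G\<^sub>1 \<union> parcs G\<^sub>2 \<union> {(r, c\<^sub>1), (c\<^sub>1, r), (r, c\<^sub>2), (c\<^sub>2, r)} \<rparr>"

inductive recursive_tree :: "'a pair_pre_digraph \<Rightarrow> 'a \<Rightarrow> nat \<Rightarrow> bool" where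
  single: "recursive_tree \<lparr> pverts = {r}, parcs = {} \<rparr> r 0"
| join: "recursive_tree (join_at_root r G\<^sub>1 c\<^sub>1 G\<^sub>2 c\<^sub>2) r (Suc k)"
    if "recursive_tree G\<^sub>1 c\<^sub>1 k" "recursive_tree G\<^sub>2 c\<^sub>2 k"
      "r \<notin> pverts G\<^sub>1 \<union> pverts G\<^sub>2" "pverts G\<^sub>1 \<inter> pverts G\<^sub>2 = {}"

lemma recursive_tree_wf:
  assumes "recursive_tree G r k"
  shows "r \<in> pverts G" "finite (pverts G)" "parcs G \<subseteq> pverts G \<times> pverts G"
  using assms by (induction rule: recursive_tree.induct) (auto simp: join_at_root_def)

text \<open>
  Every arc leads from a parent to a child or back, so an arc below \<open>v\<close> either has \<open>v\<close> as an
  end or stays below one of the two children.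
\<close>

lemma (in rooted_tree) subtree_join:
  assumes "children v = {a, b}" "a \<noteq> b"
  shows "subtree v = join_at_root v (subtree a) a (subtree b) b"
proof -
  let ?D = descendants
  have ab: "a \<in> children v" "b \<in> children v"
    using assms by auto
  have D: "?D v = insert v (?D a \<union> ?D b)"
    using descendants_unfold[of v] assms by simp
  have child: "x = v \<and> y \<in> {a, b} \<or> x \<in> ?D a \<and> y \<in> ?D a \<or> x \<in> ?D b \<and> y \<in> ?D b"
    if y: "y \<in> children x" and x: "x \<in> ?D v" for x y
  proof -
    consider "x = v" | "x \<in> ?D a" | "x \<in> ?D b"
      using x unfolding D by blast
    then show ?thesis
    proof cases
      case 1
      then show ?thesis using y assms(1) by simp
    next
      case 2
      then show ?thesis using descendants_step[OF 2 y] by simp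
    next
      case 3
      then show ?thesis using descendants_step[OF 3 y] by simp
    qed
  qed
  have "parcs T \<inter> ?D v \<times> ?D v =
      parcs T \<inter> ?D a \<times> ?D a \<union> parcs T \<inter> ?D b \<times> ?D b \<union> {(v, a), (a, v), (v, b), (b, v)}"
    (is "?L = ?R")
  proof
    show "?L \<subseteq> ?R"
    proof
      fix e assume "e \<in> ?L"
      then obtain x y where e: "e = (x, y)" "(x, y) \<in> parcs T" "x \<in> ?D v" "y \<in> ?D v"
        by auto
      from arc_parent_child[OF e(2)] show "e \<in> ?R"
      proof
        assume "y \<in> children x"
        from child[OF this e(3)] e(1,2) show ?thesis by auto
      next
        assume "x \<in> children y"
        from child[OF this e(4)] e(1,2) show ?thesis by auto
      qed
    qed
    show "?R \<subseteq> ?L"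
      using childrenD[OF ab(1)] childrenD[OF ab(2)] D by auto
  qed
  then show ?thesis
    using D by (simp add: subtree_def join_at_root_def)
qed

text \<open>
  Below a non-leaf at depth \<open>h\<close> or more every vertex would be a non-leaf again, so there would be
  vertices at every depth.
\<close>

lemma (in perfect_binary_tree) leaf_if_depth_ge:
  assumes "v \<in> pverts T" "depth v \<ge> h"
  shows "leaf v"
proof (rule ccontr)
  assume nonleaf: "\<not> leaf v"
  have "\<exists>w \<in> pverts T. \<not> leaf w \<and> depth w = depth v + n" for n
  proof (induction n)
    case 0
    show ?case using nonleaf assms by auto
  next
    case (Suc n)
    then obtain w where w: "w \<in> pverts T" "\<not> leaf w" "depth w = depth v + n"
      by blast
    then obtain x where x: "x \<in> children w"
      by (auto simp: leaf_def)
    then have "depth x = depth v + Suc n" "x \<in> pverts T"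
      using childrenD[OF x] w by auto
    moreover have "\<not> leaf x"
      using leaf_depth[of x] calculation assms(2) by auto
    ultimately show ?case by blast
  qed
  then have "range (\<lambda>n. depth v + n) \<subseteq> depth ` pverts T"
    by (auto simp: image_iff) metis
  then have "finite (range (\<lambda>n. depth v + n))"
    using pair_finite_verts finite_surj by blast
  then show False
    using finite_imageD[of "\<lambda>n. depth v + n" UNIV] by (auto simp: inj_on_def)
qed

lemma (in perfect_binary_tree) recursive_subtree:
  assumes "v \<in> pverts T" "depth v + k = h"
  shows "recursive_tree (subtree v) v k"
  using assms
proof (induction k arbitrary: v)
  case 0
  then have "children v = {}"
    using leaf_if_depth_ge by (auto simp: leaf_def)
  then have "subtree v = \<lparr> pverts = {v}, parcs = {} \<rparr>"
    using descendants_unfold[of v] no_loops' by (auto simp: subtree_def)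
  then show ?case
    by (simp add: recursive_tree.single)
next
  case (Suc k)
  then have "\<not> leaf v"
    using leaf_depth[of v] by auto
  then obtain a b where ab: "children v = {a, b}" "a \<noteq> b"
    using two_children Suc.prems(1) by (meson card_2_iff)
  then have in_children: "a \<in> children v" "b \<in> children v"
    by auto
  note a = childrenD[OF in_children(1)] and b = childrenD[OF in_children(2)]
  have "recursive_tree (subtree a) a k" "recursive_tree (subtree b) b k"
    using Suc.IH[OF a(4)] Suc.IH[OF b(4)] Suc.prems(2) a(5) b(5) by auto
  moreover have "v \<notin> pverts (subtree a) \<union> pverts (subtree b)"
    using root_notin_child_subtree in_children by blast
  moreover have "pverts (subtree a) \<inter> pverts (subtree b) = {}"
    using descendants_disjoint[OF _ ab(2)] a(5) b(5) by (simp add: subtree_def)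
  ultimately show ?case
    unfolding subtree_join[OF ab] by (rule recursive_tree.join)
qed

lemma (in perfect_binary_tree) recursive_tree: "recursive_tree T r h"
proof -
  have "parcs T \<inter> pverts T \<times> pverts T = parcs T"
    by (auto dest: in_arcsD1 in_arcsD2)
  then have "subtree r = T"
    by (simp add: subtree_def descendants_root)
  then show ?thesis
    using recursive_subtree[of r h] root_in_verts by simp
qed

section \<open>Vertex covers that are minimal except at given vertices\<close>

text \<open>
  Vertices of the exempt set \<open>S\<close> may lie in the cover without having a neighbour outside it. This is
  needed for subtrees: their root can be saved by its parent, which the subtree does not see.
\<close>

definition cover_minimal_outside :: "'a pair_pre_digraph \<Rightarrow> 'a set \<Rightarrow> 'a set \<Rightarrow> bool" where
  "cover_minimal_outside G S C \<longleftrightarrow>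
    vertex_cover G C \<and> (\<forall>x \<in> C - S. \<exists>y. (x, y) \<in> parcs G \<and> y \<notin> C)"

text \<open>
  A vertex can be removed from a cover exactly when all its neighbours are in the cover.
\<close>

lemma (in pair_graph) minimal_vertex_cover_iff:
  "minimal_vertex_cover G C \<longleftrightarrow> cover_minimal_outside G {} C"
proof
  assume C: "minimal_vertex_cover G C"
  have "\<exists>y. (x, y) \<in> parcs G \<and> y \<notin> C" if "x \<in> C" for x
  proof -
    have "\<not> vertex_cover G (C - {x})"
      using C that by (auto simp: minimal_vertex_cover_def)
    then obtain a b where "(a, b) \<in> parcs G" "a \<notin> C - {x}" "b \<notin> C - {x}"
      using C by (auto simp: minimal_vertex_cover_def vertex_cover_def)
    moreover from this have "a \<in> C \<or> b \<in> C" "a \<noteq> b"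
      using C no_loops' by (auto simp: minimal_vertex_cover_def vertex_cover_def)
    ultimately show ?thesis
      using arcs_symmetric by blast
  qed
  then show "cover_minimal_outside G {} C"
    using C by (auto simp: cover_minimal_outside_def minimal_vertex_cover_def)
next
  assume C: "cover_minimal_outside G {} C"
  have "\<not> vertex_cover G D" if "D \<subset> C" for D
    using that C by (fastforce simp: cover_minimal_outside_def vertex_cover_def)
  then show "minimal_vertex_cover G C"
    using C by (auto simp: cover_minimal_outside_def minimal_vertex_cover_def)
qed

definition covers_with_root :: "'a pair_pre_digraph \<Rightarrow> 'a \<Rightarrow> 'a set set" where
  "covers_with_root G r = {C. cover_minimal_outside G {} C \<and> r \<in> C}"

definition covers_without_root :: "'a pair_pre_digraph \<Rightarrow> 'a \<Rightarrow> 'a set set" where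
  "covers_without_root G r = {C. cover_minimal_outside G {} C \<and> r \<notin> C}"

definition covers_with_forced_root :: "'a pair_pre_digraph \<Rightarrow> 'a \<Rightarrow> 'a set set" where
  "covers_with_forced_root G r = {C. cover_minimal_outside G {r} C \<and> r \<in> C}"

lemmas cover_family_defs =
  covers_with_root_def covers_without_root_def covers_with_forced_root_def

lemma cover_families_subset:
  "covers_with_root G r \<subseteq> Pow (pverts G)"
  "covers_without_root G r \<subseteq> Pow (pverts G)"
  "covers_with_forced_root G r \<subseteq> Pow (pverts G)"
  by (auto simp: cover_family_defs cover_minimal_outside_def vertex_cover_def)

lemma card_minimal_outside:
  assumes "finite (pverts G)"
  shows "card {C. cover_minimal_outside G {} C} =
    card (covers_with_root G r) + card (covers_without_root G r)"
proof -
  have "{C. cover_minimal_outside G {} C} = covers_with_root G r \<union> covers_without_root G r"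
    by (auto simp: cover_family_defs)
  moreover have "covers_with_root G r \<inter> covers_without_root G r = {}"
    by (auto simp: cover_family_defs)
  moreover have "finite (covers_with_root G r)" "finite (covers_without_root G r)"
    using cover_families_subset assms by (meson finite_Pow_iff finite_subset)+
  ultimately show ?thesis
    by (simp add: card_Un_disjoint)
qed

section \<open>Covers of two trees joined at a new root\<close>

locale joined_at_root =
  fixes r :: 'a and G\<^sub>1 :: "'a pair_pre_digraph" and c\<^sub>1 :: 'a and G\<^sub>2 :: "'a pair_pre_digraph" and c\<^sub>2 :: 'a
  assumes fresh_root: "r \<notin> pverts G\<^sub>1 \<union> pverts G\<^sub>2"
    and disjoint: "pverts G\<^sub>1 \<inter> pverts G\<^sub>2 = {}"
    and roots: "c\<^sub>1 \<in> pverts G\<^sub>1" "c\<^sub>2 \<in> pverts G\<^sub>2"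
    and wf: "parcs G\<^sub>1 \<subseteq> pverts G\<^sub>1 \<times> pverts G\<^sub>1" "parcs G\<^sub>2 \<subseteq> pverts G\<^sub>2 \<times> pverts G\<^sub>2"
    and fin: "finite (pverts G\<^sub>1)" "finite (pverts G\<^sub>2)"
begin

abbreviation "J \<equiv> join_at_root r G\<^sub>1 c\<^sub>1 G\<^sub>2 c\<^sub>2"

text \<open>
  Sets of vertices of the joined tree that are determined by independent choices on the two
  subtrees, the membership of the root being prescribed.
\<close>

definition split_family :: "bool \<Rightarrow> 'a set set \<Rightarrow> 'a set set \<Rightarrow> 'a set set" where
  "split_family b F\<^sub>1 F\<^sub>2 =
    {C. C \<subseteq> pverts J \<and> (r \<in> C \<longleftrightarrow> b) \<and> C \<inter> pverts G\<^sub>1 \<in> F\<^sub>1 \<and> C \<inter> pverts G\<^sub>2 \<in> F\<^sub>2}"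

lemma pverts_J: "pverts J = insert r (pverts G\<^sub>1 \<union> pverts G\<^sub>2)"
  by (simp add: join_at_root_def)

lemma parcs_J:
  "parcs J = parcs G\<^sub>1 \<union> parcs G\<^sub>2 \<union> {(r, c\<^sub>1), (c\<^sub>1, r), (r, c\<^sub>2), (c\<^sub>2, r)}"
  by (simp add: join_at_root_def)

lemma finite_split_family: "finite (split_family b F\<^sub>1 F\<^sub>2)"
  by (rule finite_subset[of _ "Pow (pverts J)"]) (auto simp: split_family_def pverts_J fin)

lemma card_split_family:
  assumes "F\<^sub>1 \<subseteq> Pow (pverts G\<^sub>1)" "F\<^sub>2 \<subseteq> Pow (pverts G\<^sub>2)"
  shows "card (split_family b F\<^sub>1 F\<^sub>2) = card F\<^sub>1 * card F\<^sub>2"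
proof -
  let ?f = "\<lambda>(C\<^sub>1, C\<^sub>2). (if b then {r} else {}) \<union> C\<^sub>1 \<union> C\<^sub>2"
  let ?g = "\<lambda>C. (C \<inter> pverts G\<^sub>1, C \<inter> pverts G\<^sub>2)"
  have "bij_betw ?g (split_family b F\<^sub>1 F\<^sub>2) (F\<^sub>1 \<times> F\<^sub>2)"
  proof (rule bij_betw_byWitness[where f' = ?f])
    show "\<forall>C \<in> split_family b F\<^sub>1 F\<^sub>2. ?f (?g C) = C"
      by (auto simp: split_family_def pverts_J)
    have parts: "?g (?f (C\<^sub>1, C\<^sub>2)) = (C\<^sub>1, C\<^sub>2)" if "C\<^sub>1 \<in> F\<^sub>1" "C\<^sub>2 \<in> F\<^sub>2" for C\<^sub>1 C\<^sub>2
    proof -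
      have "C\<^sub>1 \<subseteq> pverts G\<^sub>1" "C\<^sub>2 \<subseteq> pverts G\<^sub>2"
        using that assms by auto
      then show ?thesis
        using fresh_root disjoint by auto
    qed
    then show "\<forall>P \<in> F\<^sub>1 \<times> F\<^sub>2. ?g (?f P) = P"
      by blast
    show "?g ` split_family b F\<^sub>1 F\<^sub>2 \<subseteq> F\<^sub>1 \<times> F\<^sub>2"
      by (auto simp: split_family_def)
    show "?f ` (F\<^sub>1 \<times> F\<^sub>2) \<subseteq> split_family b F\<^sub>1 F\<^sub>2"
    proof clarify
      fix C\<^sub>1 C\<^sub>2 assume C: "C\<^sub>1 \<in> F\<^sub>1" "C\<^sub>2 \<in> F\<^sub>2"
      then have "C\<^sub>1 \<subseteq> pverts G\<^sub>1" "C\<^sub>2 \<subseteq> pverts G\<^sub>2"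
        using assms by auto
      then show "(if b then {r} else {}) \<union> C\<^sub>1 \<union> C\<^sub>2 \<in> split_family b F\<^sub>1 F\<^sub>2"
        using parts[OF C] C fresh_root by (auto simp: split_family_def pverts_J)
    qed
  qed
  from bij_betw_same_card[OF this] show ?thesis
    by (simp add: card_cartesian_product)
qed

lemma vertex_cover_J:
  "vertex_cover J C \<longleftrightarrow> C \<subseteq> pverts J \<and>
    vertex_cover G\<^sub>1 (C \<inter> pverts G\<^sub>1) \<and> vertex_cover G\<^sub>2 (C \<inter> pverts G\<^sub>2) \<and>
    (r \<in> C \<or> c\<^sub>1 \<in> C \<and> c\<^sub>2 \<in> C)"
proof -
  have restrict: "(\<forall>(u, v) \<in> parcs G. u \<in> C \<or> v \<in> C) \<longleftrightarrow>
      (\<forall>(u, v) \<in> parcs G. u \<in> C \<inter> pverts G \<or> v \<in> C \<inter> pverts G)"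
    if "parcs G \<subseteq> pverts G \<times> pverts G" for G :: "'a pair_pre_digraph"
    using that by (intro ball_cong) auto
  show ?thesis
    unfolding vertex_cover_def parcs_J ball_Un restrict[OF wf(1)] restrict[OF wf(2)] by auto
qed

lemma outside_neighbour_J:
  "(\<exists>y. (r, y) \<in> parcs J \<and> y \<notin> C) \<longleftrightarrow> c\<^sub>1 \<notin> C \<or> c\<^sub>2 \<notin> C"
  "x \<in> pverts G\<^sub>1 \<Longrightarrow> (\<exists>y. (x, y) \<in> parcs J \<and> y \<notin> C) \<longleftrightarrow>
    (\<exists>y. (x, y) \<in> parcs G\<^sub>1 \<and> y \<notin> C \<inter> pverts G\<^sub>1) \<or> x = c\<^sub>1 \<and> r \<notin> C"
  "x \<in> pverts G\<^sub>2 \<Longrightarrow> (\<exists>y. (x, y) \<in> parcs J \<and> y \<notin> C) \<longleftrightarrow>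
    (\<exists>y. (x, y) \<in> parcs G\<^sub>2 \<and> y \<notin> C \<inter> pverts G\<^sub>2) \<or> x = c\<^sub>2 \<and> r \<notin> C"
  using wf fresh_root disjoint roots by (auto simp: parcs_J)

lemma ball_split:
  assumes "C \<subseteq> pverts J"
  shows "(\<forall>x \<in> C. P x) \<longleftrightarrow>
    (r \<in> C \<longrightarrow> P r) \<and> (\<forall>x \<in> C \<inter> pverts G\<^sub>1. P x) \<and> (\<forall>x \<in> C \<inter> pverts G\<^sub>2. P x)"
  using assms by (auto simp: pverts_J)

text \<open>
  The only outside neighbour that a vertex of a subtree gains by the join is \<open>r\<close>, and only the root of
  the subtree gains it.
\<close>

lemma minimal_outside_J:
  assumes "C \<subseteq> pverts J"
  shows "cover_minimal_outside J S C \<longleftrightarrow>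
    vertex_cover J C \<and>
    (r \<in> C \<longrightarrow> r \<in> S \<or> c\<^sub>1 \<notin> C \<or> c\<^sub>2 \<notin> C) \<and>
    (\<forall>x \<in> C \<inter> pverts G\<^sub>1. x \<in> S \<or>
      (\<exists>y. (x, y) \<in> parcs G\<^sub>1 \<and> y \<notin> C \<inter> pverts G\<^sub>1) \<or> x = c\<^sub>1 \<and> r \<notin> C) \<and>
    (\<forall>x \<in> C \<inter> pverts G\<^sub>2. x \<in> S \<or>
      (\<exists>y. (x, y) \<in> parcs G\<^sub>2 \<and> y \<notin> C \<inter> pverts G\<^sub>2) \<or> x = c\<^sub>2 \<and> r \<notin> C)"
proof -
  have "cover_minimal_outside J S C \<longleftrightarrow>
    vertex_cover J C \<and> (\<forall>x \<in> C. x \<in> S \<or> (\<exists>y. (x, y) \<in> parcs J \<and> y \<notin> C))"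
    unfolding cover_minimal_outside_def by blast
  also have "\<dots> \<longleftrightarrow> vertex_cover J C \<and>
    (r \<in> C \<longrightarrow> r \<in> S \<or> (\<exists>y. (r, y) \<in> parcs J \<and> y \<notin> C)) \<and>
    (\<forall>x \<in> C \<inter> pverts G\<^sub>1. x \<in> S \<or> (\<exists>y. (x, y) \<in> parcs J \<and> y \<notin> C)) \<and>
    (\<forall>x \<in> C \<inter> pverts G\<^sub>2. x \<in> S \<or> (\<exists>y. (x, y) \<in> parcs J \<and> y \<notin> C))"
    unfolding ball_split[OF assms] ..
  also have "\<dots> \<longleftrightarrow> vertex_cover J C \<and>
    (r \<in> C \<longrightarrow> r \<in> S \<or> c\<^sub>1 \<notin> C \<or> c\<^sub>2 \<notin> C) \<and>
    (\<forall>x \<in> C \<inter> pverts G\<^sub>1. x \<in> S \<or>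
      (\<exists>y. (x, y) \<in> parcs G\<^sub>1 \<and> y \<notin> C \<inter> pverts G\<^sub>1) \<or> x = c\<^sub>1 \<and> r \<notin> C) \<and>
    (\<forall>x \<in> C \<inter> pverts G\<^sub>2. x \<in> S \<or>
      (\<exists>y. (x, y) \<in> parcs G\<^sub>2 \<and> y \<notin> C \<inter> pverts G\<^sub>2) \<or> x = c\<^sub>2 \<and> r \<notin> C)"
    by (intro conj_cong imp_cong ball_cong disj_cong refl outside_neighbour_J) auto
  finally show ?thesis .
qed

text \<open>With \<open>r\<close> in the cover and exempt, the two restrictions only have to be minimal covers.\<close>

lemma forced_root_J:
  "covers_with_forced_root J r =
    split_family True {C. cover_minimal_outside G\<^sub>1 {} C} {C. cover_minimal_outside G\<^sub>2 {} C}"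
proof -
  have "cover_minimal_outside J {r} C \<longleftrightarrow> cover_minimal_outside G\<^sub>1 {} (C \<inter> pverts G\<^sub>1) \<and>
      cover_minimal_outside G\<^sub>2 {} (C \<inter> pverts G\<^sub>2)"
    if "C \<subseteq> pverts J" "r \<in> C" for C
  proof -
    have "x \<noteq> r" if "x \<in> pverts G\<^sub>1 \<union> pverts G\<^sub>2" for x
      using that fresh_root by auto
    then show ?thesis
      unfolding minimal_outside_J[OF that(1)] vertex_cover_J
      using that unfolding cover_minimal_outside_def by auto
  qed
  then show ?thesis
    unfolding covers_with_forced_root_def split_family_def
    by (auto simp: cover_minimal_outside_def[of J] vertex_cover_def[of J])
qed

text \<open>The root now needs an outside neighbour itself: not both children may be in the cover.\<close>

lemma with_root_J:
  "covers_with_root J r =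
    split_family True {C. cover_minimal_outside G\<^sub>1 {} C} {C. cover_minimal_outside G\<^sub>2 {} C} -
    split_family True (covers_with_root G\<^sub>1 c\<^sub>1) (covers_with_root G\<^sub>2 c\<^sub>2)"
proof -
  have "cover_minimal_outside J {} C \<longleftrightarrow>
      cover_minimal_outside J {r} C \<and> (c\<^sub>1 \<notin> C \<or> c\<^sub>2 \<notin> C)" if "r \<in> C" for C
    using that outside_neighbour_J(1)[of C] unfolding cover_minimal_outside_def by auto
  then have "covers_with_root J r =
      covers_with_forced_root J r - {C. c\<^sub>1 \<in> C \<and> c\<^sub>2 \<in> C}"
    by (auto simp: cover_family_defs)
  also have "\<dots> = covers_with_forced_root J r -
      split_family True (covers_with_root G\<^sub>1 c\<^sub>1) (covers_with_root G\<^sub>2 c\<^sub>2)"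
    unfolding forced_root_J using roots
    by (auto simp: split_family_def covers_with_root_def)
  finally show ?thesis
    unfolding forced_root_J .
qed

text \<open>
  With \<open>r\<close> outside, its arcs force both children into the cover and exempt them within their
  subtrees.
\<close>

lemma without_root_J:
  "covers_without_root J r =
    split_family False (covers_with_forced_root G\<^sub>1 c\<^sub>1) (covers_with_forced_root G\<^sub>2 c\<^sub>2)"
proof -
  have "cover_minimal_outside J {} C \<longleftrightarrow>
      C \<inter> pverts G\<^sub>1 \<in> covers_with_forced_root G\<^sub>1 c\<^sub>1 \<and>
      C \<inter> pverts G\<^sub>2 \<in> covers_with_forced_root G\<^sub>2 c\<^sub>2"
    if "C \<subseteq> pverts J" "r \<notin> C" for C
    unfolding minimal_outside_J[OF that(1)] vertex_cover_J
    using that roots unfolding covers_with_forced_root_def cover_minimal_outside_def by auto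
  then show ?thesis
    unfolding covers_without_root_def split_family_def
    by (auto simp: cover_minimal_outside_def[of J] vertex_cover_def[of J])
qed

end

section \<open>The recurrence\<close>

text \<open>
  The components count the covers with the root, those without it, and those with the root exempt but
  forced into the cover. The single vertex has no cover of the first kind: its root has no
  neighbour.
\<close>

fun cover_counts :: "nat \<Rightarrow> nat \<times> nat \<times> nat" where
  "cover_counts 0 = (0, 1, 1)"
| "cover_counts (Suc k) = (case cover_counts k of (a, b, w) \<Rightarrow> ((a + b)\<^sup>2 - a\<^sup>2, w\<^sup>2, (a + b)\<^sup>2))"

lemma card_cover_families:
  assumes "recursive_tree G r k"
  shows "(card (covers_with_root G r), card (covers_without_root G r),
    card (covers_with_forced_root G r)) = cover_counts k"
  using assms
proof (induction rule: recursive_tree.induct)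
  case (single r)
  let ?G = "\<lparr> pverts = {r}, parcs = {} \<rparr>"
  have "covers_with_root ?G r = {}" "covers_without_root ?G r = {{}}"
    "covers_with_forced_root ?G r = {{r}}"
    by (auto simp: cover_family_defs cover_minimal_outside_def vertex_cover_def)
  then show ?case by simp
next
  case (join G\<^sub>1 c\<^sub>1 k G\<^sub>2 c\<^sub>2 r)
  note wf1 = recursive_tree_wf[OF join.hyps(1)] and wf2 = recursive_tree_wf[OF join.hyps(2)]
  interpret joined_at_root r G\<^sub>1 c\<^sub>1 G\<^sub>2 c\<^sub>2
    by unfold_locales (use join.hyps wf1 wf2 in auto)
  let ?M = "\<lambda>G. {C. cover_minimal_outside G {} C}"
  obtain a b w where abw: "cover_counts k = (a, b, w)"
    by (cases "cover_counts k")
  have M: "card (?M G\<^sub>1) = a + b" "card (?M G\<^sub>2) = a + b"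
    using card_minimal_outside[of G\<^sub>1 c\<^sub>1] card_minimal_outside[of G\<^sub>2 c\<^sub>2] fin join.IH abw by auto
  have MPow: "?M G \<subseteq> Pow (pverts G)" for G :: "'a pair_pre_digraph"
    by (auto simp: cover_minimal_outside_def vertex_cover_def)
  have forced: "card (covers_with_forced_root J r) = (a + b)\<^sup>2"
    unfolding forced_root_J by (simp add: card_split_family MPow M power2_eq_square)
  have "split_family True (covers_with_root G\<^sub>1 c\<^sub>1) (covers_with_root G\<^sub>2 c\<^sub>2) \<subseteq>
      split_family True (?M G\<^sub>1) (?M G\<^sub>2)"
    by (auto simp: split_family_def covers_with_root_def)
  then have "card (covers_with_root J r) = (a + b)\<^sup>2 - a\<^sup>2"
    unfolding with_root_J using join.IH abw
    by (simp add: card_Diff_subset finite_split_family card_split_family MPow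
        cover_families_subset M power2_eq_square)
  moreover have "card (covers_without_root J r) = w\<^sup>2"
    unfolding without_root_J using join.IH abw
    by (simp add: card_split_family cover_families_subset power2_eq_square)
  ultimately show ?case
    using forced abw by simp
qed

lemma card_minimal_vertex_covers:
  assumes "perfect_binary_tree T r h" "cover_counts h = (a, b, w)"
  shows "card {C. minimal_vertex_cover T C} = a + b"
proof -
  interpret perfect_binary_tree T r h by fact
  show ?thesis
    using card_minimal_outside[of T r] card_cover_families[OF recursive_tree] pair_finite_verts
      assms(2)
    by (simp add: minimal_vertex_cover_iff)
qed

theorem theorem1p1:
  fixes T :: "nat \<Rightarrow> 'a pair_pre_digraph" and r :: "nat \<Rightarrow> 'a" and m :: "nat \<Rightarrow> nat"
  assumes "\<And>h. perfect_binary_tree (T h) (r h) h"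
    and "\<And>h. m h = card {C. minimal_vertex_cover (T h) C}"
  shows "m 0 = 1 \<and> m 1 = 2 \<and> m 2 = 4 \<and>
    (\<forall>h\<ge>2. int (m (h + 1)) =
      2 * int (m h) * int (m (h - 2)) ^ 4 + int (m (h - 1)) ^ 4 - int (m (h - 2)) ^ 8)"
proof -
  have m: "m h = a + b" if "cover_counts h = (a, b, w)" for h a b w
    using card_minimal_vertex_covers[OF assms(1) that] assms(2) by simp
  have "m 0 = 1" "m 1 = 2" "m 2 = 4"
    using m[of 0] m[of 1] m[of 2] by (simp_all add: numeral_2_eq_2)
  moreover have "int (m (h + 1)) =
      2 * int (m h) * int (m (h - 2)) ^ 4 + int (m (h - 1)) ^ 4 - int (m (h - 2)) ^ 8"
    if h2: "h \<ge> 2" for h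
  proof -
    obtain k where h: "h = Suc (Suc k)"
      using le_Suc_ex[OF h2] by auto
    obtain a b w where k: "cover_counts k = (a, b, w)"
      by (cases "cover_counts k")
    define n a' where "n = a + b" and "a' = n\<^sup>2 - a\<^sup>2"
    define n' where "n' = a' + w\<^sup>2"
    define a'' where "a'' = n'\<^sup>2 - a'\<^sup>2"
    define n'' where "n'' = a'' + n ^ 4"
    \<comment> \<open>\<open>n\<close>, \<open>n'\<close>, \<open>n''\<close> are the totals at the heights \<open>k\<close>, \<open>k + 1\<close>, \<open>h = k + 2\<close>.\<close>
    have k1: "cover_counts (Suc k) = (a', w\<^sup>2, n\<^sup>2)"
      using k by (simp add: n_def a'_def)
    have k2: "cover_counts h = (a'', n ^ 4, n'\<^sup>2)"
      using k1 by (simp add: h a''_def n'_def)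
    have k3: "cover_counts (h + 1) = (n''\<^sup>2 - a''\<^sup>2, n' ^ 4, n''\<^sup>2)"
      using k2 by (simp add: n''_def)
    have "int (m (h + 1)) = int (n''\<^sup>2 - a''\<^sup>2) + int n' ^ 4"
      using m[OF k3] by simp
    also have "int (n''\<^sup>2 - a''\<^sup>2) = int n'' ^ 2 - int a'' ^ 2"
      by (simp add: n''_def of_nat_diff power_mono)
    \<comment> \<open>\<open>n ^ 4\<close> counts the covers without the root, so \<open>a''\<close> is determined by the totals alone.\<close>
    also have "int a'' = int n'' - int n ^ 4"
      by (simp add: n''_def)
    also have "(int n'')\<^sup>2 - (int n'' - int n ^ 4)\<^sup>2 + int n' ^ 4 =
        2 * int n'' * int n ^ 4 + int n' ^ 4 - int n ^ 8"
      by algebra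
    finally show ?thesis
      using m[OF k] m[OF k1] m[OF k2] by (simp add: h n_def n'_def n''_def)
  qed
  ultimately show ?thesis by blast
qed

end
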